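(* Let $p$ and $q$ be prime numbers with $p<q$, and let $X$ be a finite indecomposable cycle set of cardinality $pq$ with cyclic permutation group $\mathcal{G}(X)=\langle\alpha\rangle$. Then $X$ has multipermutational level $1$.
   Context: A cycle set is a non-empty set $X$ with a binary operation $\cdot$ such that every left multiplication $\sigma_x:X\to X,\ y\mapsto x\cdot y$ is bijective and $(x\cdot y)\cdot(x\cdot z)=(y\cdot x)\cdot(y\cdot z)$ for all $x,y,z\in X$. The permutation group $\mathcal{G}(X)$ is the subgroup of $Sym(X)$ generated by $\{\sigma_x\mid x\in X\}$. $X$ is indecomposable if there is no partition $\{Y,Z\}$ of $X$ into non-empty subsets with $\sigma_x(Y)\subseteq Y$ and $\sigma_x(Z)\subseteq Z$ for all $x\in X$ (equivalently, $\mathcal{G}(X)$ is transitive on $X$). For a non-degenerate cycle set (i.e. $x\mapsto x\cdot x$ is bijective; every finite cycle set is non-degenerate) the retraction is the cycle set $\sigma(X):=\{\sigma_x\mid x\in X\}$ with $\sigma_x\cdot\sigma_y:=\sigma_{x\cdot y}$; one puts $\sigma^0(X):=X$, $\sigma^m(X):=\sigma(\sigma^{m-1}(X))$ for $m\ge1$. $X$ is multipermutational of level $m$ if $m$ is the minimal non-negative integer with $|\sigma^m(X)|=1$. *)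

theory Defs
  imports "HOL-Algebra.Elementary_Groups" "HOL-Algebra.Bij" "HOL-Computational_Algebra.Primes"
begin

record 'a magma = "'a partial_object" +
  cdot :: "'a \<Rightarrow> 'a \<Rightarrow> 'a" (infixl "\<cdot>\<index>" 70)

text \<open>The left multiplication by \<open>x\<close>, made extensional on the carrier so that equality of left
  multiplications is equality as maps on the carrier, as required for elements of \<^const>\<open>BijGroup\<close>.\<close>

definition lmult :: "'a magma \<Rightarrow> 'a \<Rightarrow> 'a \<Rightarrow> 'a" ("\<sigma>\<index>")
  where "\<sigma>\<^bsub>X\<^esub> x = (\<lambda>y\<in>carrier X. x \<cdot>\<^bsub>X\<^esub> y)"

definition cycle_set :: "'a magma \<Rightarrow> bool"
  where "cycle_set X \<longleftrightarrow> carrier X \<noteq> {} \<and>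
    (\<forall>x\<in>carrier X. bij_betw (\<sigma>\<^bsub>X\<^esub> x) (carrier X) (carrier X)) \<and>
    (\<forall>x\<in>carrier X. \<forall>y\<in>carrier X. \<forall>z\<in>carrier X.
      (x \<cdot>\<^bsub>X\<^esub> y) \<cdot>\<^bsub>X\<^esub> (x \<cdot>\<^bsub>X\<^esub> z) = (y \<cdot>\<^bsub>X\<^esub> x) \<cdot>\<^bsub>X\<^esub> (y \<cdot>\<^bsub>X\<^esub> z))"

definition perm_group :: "'a magma \<Rightarrow> ('a \<Rightarrow> 'a) monoid"
  where "perm_group X = subgroup_generated (BijGroup (carrier X)) (\<sigma>\<^bsub>X\<^esub> ` carrier X)"

definition indecomposable :: "'a magma \<Rightarrow> bool"
  where "indecomposable X \<longleftrightarrow> \<not> (\<exists>Y Z. Y \<noteq> {} \<and> Z \<noteq> {} \<and> Y \<inter> Z = {} \<and> Y \<union> Z = carrier X \<and>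
    (\<forall>x\<in>carrier X. \<sigma>\<^bsub>X\<^esub> x ` Y \<subseteq> Y \<and> \<sigma>\<^bsub>X\<^esub> x ` Z \<subseteq> Z))"

text \<open>The retraction. That the description determines a value is shown in
  \<open>retraction_cdot\<close> below.\<close>

definition retraction :: "'a magma \<Rightarrow> ('a \<Rightarrow> 'a) magma"
  where "retraction X =
    \<lparr>carrier = \<sigma>\<^bsub>X\<^esub> ` carrier X,
     cdot = \<lambda>f g. THE h. \<exists>x\<in>carrier X. \<exists>y\<in>carrier X.
       f = \<sigma>\<^bsub>X\<^esub> x \<and> g = \<sigma>\<^bsub>X\<^esub> y \<and> h = \<sigma>\<^bsub>X\<^esub> (x \<cdot>\<^bsub>X\<^esub> y)\<rparr>"

text \<open>The retraction has a different type from \<open>X\<close>, so it cannot be iterated directly inside HOL.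
  We therefore iterate an isomorphic copy of it on the original type, obtained by transporting its
  operation along a bijection onto a set of representatives
  (see \<open>retract_bij\<close> and \<open>retract_hom\<close>).\<close>

definition transport :: "('a \<Rightarrow> 'b) \<Rightarrow> 'a magma \<Rightarrow> 'b magma"
  where "transport r Y =
    \<lparr>carrier = r ` carrier Y,
     cdot = \<lambda>a b. r (inv_into (carrier Y) r a \<cdot>\<^bsub>Y\<^esub> inv_into (carrier Y) r b)\<rparr>"

definition retract :: "'a magma \<Rightarrow> 'a magma"
  where "retract X = transport (inv_into (carrier X) (\<sigma>\<^bsub>X\<^esub>)) (retraction X)"

definition multipermutational_of_level :: "'a magma \<Rightarrow> nat \<Rightarrow> bool"
  where "multipermutational_of_level X m \<longleftrightarrow>
    card (carrier ((retract ^^ m) X)) = 1 \<and> (\<forall>k<m. card (carrier ((retract ^^ k) X)) \<noteq> 1)"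

lemma cycle_set_closed:
  assumes "cycle_set X" "x \<in> carrier X" "y \<in> carrier X"
  shows "x \<cdot>\<^bsub>X\<^esub> y \<in> carrier X"
proof -
  have "bij_betw (\<sigma>\<^bsub>X\<^esub> x) (carrier X) (carrier X)"
    using assms unfolding cycle_set_def by blast
  then have "\<sigma>\<^bsub>X\<^esub> x y \<in> carrier X"
    using assms(3) by (rule bij_betw_apply)
  then show ?thesis using assms(3) by (simp add: lmult_def)
qed

lemma lmult_cdot_cong:
  assumes X: "cycle_set X" and x: "x \<in> carrier X" and y: "y \<in> carrier X" and y': "y' \<in> carrier X"
    and eq: "\<sigma>\<^bsub>X\<^esub> y = \<sigma>\<^bsub>X\<^esub> y'"
  shows "\<sigma>\<^bsub>X\<^esub> (x \<cdot>\<^bsub>X\<^esub> y) = \<sigma>\<^bsub>X\<^esub> (x \<cdot>\<^bsub>X\<^esub> y')"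
proof
  fix w
  have yy: "y \<cdot>\<^bsub>X\<^esub> z = y' \<cdot>\<^bsub>X\<^esub> z" if "z \<in> carrier X" for z
    using fun_cong[OF eq, of z] that by (simp add: lmult_def)
  show "\<sigma>\<^bsub>X\<^esub> (x \<cdot>\<^bsub>X\<^esub> y) w = \<sigma>\<^bsub>X\<^esub> (x \<cdot>\<^bsub>X\<^esub> y') w"
  proof (cases "w \<in> carrier X")
    case True
    have "bij_betw (\<sigma>\<^bsub>X\<^esub> x) (carrier X) (carrier X)"
      using X x unfolding cycle_set_def by blast
    then obtain z where z: "z \<in> carrier X" "w = \<sigma>\<^bsub>X\<^esub> x z"
      using True unfolding bij_betw_def by blast
    then have w: "w = x \<cdot>\<^bsub>X\<^esub> z" by (simp add: lmult_def)
    have law: "(x \<cdot>\<^bsub>X\<^esub> u) \<cdot>\<^bsub>X\<^esub> (x \<cdot>\<^bsub>X\<^esub> z) = (u \<cdot>\<^bsub>X\<^esub> x) \<cdot>\<^bsub>X\<^esub> (u \<cdot>\<^bsub>X\<^esub> z)"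
      if "u \<in> carrier X" for u
      using X x z(1) that unfolding cycle_set_def by blast
    have "(x \<cdot>\<^bsub>X\<^esub> y) \<cdot>\<^bsub>X\<^esub> w = (x \<cdot>\<^bsub>X\<^esub> y') \<cdot>\<^bsub>X\<^esub> w"
      using law[OF y] law[OF y'] yy[OF x] yy[OF z(1)] w by simp
    then show ?thesis using True by (simp add: lmult_def)
  qed (simp add: lmult_def)
qed

lemma retraction_cdot:
  assumes X: "cycle_set X" and x: "x \<in> carrier X" and y: "y \<in> carrier X"
  shows "\<sigma>\<^bsub>X\<^esub> x \<cdot>\<^bsub>retraction X\<^esub> \<sigma>\<^bsub>X\<^esub> y = \<sigma>\<^bsub>X\<^esub> (x \<cdot>\<^bsub>X\<^esub> y)"
proof -
  have "h = \<sigma>\<^bsub>X\<^esub> (x \<cdot>\<^bsub>X\<^esub> y)"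
    if h: "x' \<in> carrier X" "y' \<in> carrier X" "\<sigma>\<^bsub>X\<^esub> x = \<sigma>\<^bsub>X\<^esub> x'" "\<sigma>\<^bsub>X\<^esub> y = \<sigma>\<^bsub>X\<^esub> y'"
      "h = \<sigma>\<^bsub>X\<^esub> (x' \<cdot>\<^bsub>X\<^esub> y')" for h x' y'
  proof -
    have "x \<cdot>\<^bsub>X\<^esub> y = x' \<cdot>\<^bsub>X\<^esub> y"
      using fun_cong[OF h(3), of y] y by (simp add: lmult_def)
    then show ?thesis using lmult_cdot_cong[OF X h(1) y h(2) h(4)] h(5) by simp
  qed
  then have "(THE h. \<exists>x'\<in>carrier X. \<exists>y'\<in>carrier X.
      \<sigma>\<^bsub>X\<^esub> x = \<sigma>\<^bsub>X\<^esub> x' \<and> \<sigma>\<^bsub>X\<^esub> y = \<sigma>\<^bsub>X\<^esub> y' \<and> h = \<sigma>\<^bsub>X\<^esub> (x' \<cdot>\<^bsub>X\<^esub> y')) = \<sigma>\<^bsub>X\<^esub> (x \<cdot>\<^bsub>X\<^esub> y)"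
    by (intro the_equality) (use x y in blast, metis)
  then show ?thesis unfolding retraction_def by (simp only: magma.simps)
qed

lemma retract_bij:
  "bij_betw (inv_into (carrier X) (\<sigma>\<^bsub>X\<^esub>)) (carrier (retraction X)) (carrier (retract X))"
  unfolding retract_def transport_def bij_betw_def
  by (simp add: retraction_def inj_on_inv_into)

lemma retract_hom:
  assumes "f \<in> carrier (retraction X)" "g \<in> carrier (retraction X)"
  defines "r \<equiv> inv_into (carrier X) (\<sigma>\<^bsub>X\<^esub>)"
  shows "r (f \<cdot>\<^bsub>retraction X\<^esub> g) = r f \<cdot>\<^bsub>retract X\<^esub> r g"
proof -
  have "inj_on r (carrier (retraction X))"
    using retract_bij unfolding r_def bij_betw_def by blast
  then have "inv_into (carrier (retraction X)) r (r f) = f" "inv_into (carrier (retraction X)) r (r g) = g"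
    using assms(1,2) by (simp_all add: inv_into_f_f)
  then show ?thesis
    unfolding retract_def transport_def r_def[symmetric] by (simp only: magma.simps)
qed

end

theory Submission
  imports Defs "HOL-Algebra.Multiplicative_Group" "HOL-Number_Theory.Cong"
begin

text \<open>
  Let \<open>\<alpha>\<close> generate the permutation group. Indecomposability makes the points of \<open>X\<close> a single
  \<open>\<alpha>\<close>-orbit, so \<open>X\<close> can be identified with the integers modulo \<open>n = p * q\<close>, with every left
  multiplication a translation: \<open>x \<cdot> y = y + f x\<close>
  (lemma \<open>cyclic_perm_group_coordinates\<close>). The cycle set law becomes the congruence
  \<open>f x + f (y + f x) = f y + f (x + f y)\<close>, indecomposability says that the values of \<open>f\<close> generate
  all residues, and level one means that \<open>f\<close> is constant modulo \<open>n\<close>.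

  Two observations carry the argument. First, a single trivial left multiplication forces all of
  them to be trivial, so \<open>f\<close> never vanishes modulo \<open>n\<close> (\<open>value_not_zero\<close>). Consequently \<open>f\<close> is not
  injective. Second, if \<open>f\<close> takes the same value at two points, their difference is a period of
  \<open>f\<close> (\<open>equal_values_imp_period\<close>). So \<open>f\<close> always has a period that is non-zero modulo \<open>n\<close>.

  For prime \<open>n\<close> such a period generates all residues, and \<open>f\<close> is constant. For \<open>n = p * q\<close> it
  yields one of the two primes, say \<open>b\<close>, as a period, and the prime case applied modulo \<open>b\<close> shows
  that \<open>f\<close> is constant modulo \<open>b\<close>. The remaining step, \<open>constant_if_prime_period\<close>, is an argument on
  orders: the values of \<open>f\<close> form an arithmetic progression modulo \<open>n\<close> that closes up after \<open>b\<close>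
  steps, so \<open>b\<close> times its increment is zero, while the increment is a multiple of \<open>b\<close>. As the two
  primes are distinct, the increment vanishes.
\<close>

section \<open>Translation cycle sets on the integers modulo \<open>n\<close>\<close>

definition period_mod :: "nat \<Rightarrow> (nat \<Rightarrow> nat) \<Rightarrow> nat \<Rightarrow> bool"
  where "period_mod n f h \<longleftrightarrow> (\<forall>x. [f (x + h) = f x] (mod n))"

lemma period_mod_mult:
  assumes "period_mod n f h"
  shows "period_mod n f (h * k)"
proof (induction k)
  case (Suc k)
  show ?case unfolding period_mod_def
  proof
    fix x
    have "[f (x + h * k + h) = f (x + h * k)] (mod n)"
      using assms unfolding period_mod_def by blast
    also have "[f (x + h * k) = f x] (mod n)"
      using Suc unfolding period_mod_def by blast
    finally show "[f (x + h * Suc k) = f x] (mod n)" by (simp add: algebra_simps)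
  qed
qed (simp add: period_mod_def)

lemma period_mod_cong:
  assumes "period_mod n f h" and "[x = y] (mod h)"
  shows "[f x = f y] (mod n)"
proof -
  obtain k l where "y + k * h = x + l * h"
    using assms(2) cong_iff_lin_nat by blast
  moreover have "[f (y + h * k) = f y] (mod n)" "[f (x + h * l) = f x] (mod n)"
    using period_mod_mult[OF assms(1)] unfolding period_mod_def by blast+
  ultimately show ?thesis
    by (metis cong_sym cong_trans mult.commute)
qed

lemma period_mod_gcd:
  assumes "period_mod n f h" and "period_mod n f m" and "gcd h m dvd d"
  shows "period_mod n f d"
  unfolding period_mod_def
proof
  fix x
  obtain k where k: "[h * k = d] (mod m)"
    using cong_solve_dvd_nat[OF assms(3)] by blast
  have "[f (x + d) = f (x + h * k)] (mod n)"
    by (rule period_mod_cong[OF assms(2)]) (use k in \<open>simp add: cong_add_lcancel_nat cong_sym\<close>)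
  also have "[f (x + h * k) = f x] (mod n)"
    using period_mod_mult[OF assms(1)] unfolding period_mod_def by blast
  finally show "[f (x + d) = f x] (mod n)" .
qed

lemma period_mod_one:
  assumes "period_mod n f 1"
  shows "[f x = f y] (mod n)"
  using period_mod_cong[OF assms] by simp

text \<open>The underlying cycle set is that of the integers modulo \<open>n\<close> with \<open>x \<cdot> y = y + f x\<close>. The
  assumption \<open>exchange\<close> is the cycle set law applied to \<open>x\<close>, \<open>y\<close>, \<open>z\<close>, where the summand \<open>z\<close> cancels,
  and \<open>reach\<close> is indecomposability: an invariant set of residues containing zero is everything.\<close>

locale translation_cycle_set =
  fixes n :: nat and f :: "nat \<Rightarrow> nat"
  assumes modulus: "1 < n"
    and modulus_period: "period_mod n f n"
    and exchange: "[f x + f (y + f x) = f y + f (x + f y)] (mod n)"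
    and reach: "\<lbrakk>0 \<in> S; \<And>c z. c \<in> S \<Longrightarrow> c + f z \<in> S;
      \<And>c d. \<lbrakk>c \<in> S; [c = d] (mod n)\<rbrakk> \<Longrightarrow> d \<in> S\<rbrakk> \<Longrightarrow> c \<in> S"
begin

lemmas f_cong = period_mod_cong[OF modulus_period]

lemma shift_exists: "\<exists>c. [x + c = z] (mod n)"
proof
  have "x \<le> n * x" using modulus by simp
  then have "x + (z + n * x - x) = z + n * x" by linarith
  then show "[x + (z + n * x - x) = z] (mod n)" by (simp add: cong_def)
qed

text \<open>If the translation by \<open>f x\<close> is trivial, then \<open>exchange\<close> makes the translation attached to
  every \<open>x + f z\<close> trivial as well, hence all of them, and nothing would move.\<close>

lemma value_not_zero: "\<not> [f x = 0] (mod n)"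
proof
  assume zero: "[f x = 0] (mod n)"
  have shifted: "[f (x + c) = 0] (mod n)" for c
  proof -
    have "c \<in> {c. [f (x + c) = 0] (mod n)}"
    proof (rule reach)
      show "0 \<in> {c. [f (x + c) = 0] (mod n)}" using zero by simp
    next
      fix c z
      assume "c \<in> {c. [f (x + c) = 0] (mod n)}"
      then have w: "[f (x + c) = 0] (mod n)" by simp
      have "[f z + f (x + c + f z) = f (x + c) + f (z + f (x + c))] (mod n)"
        by (rule exchange)
      also have "[f (x + c) + f (z + f (x + c)) = 0 + f z] (mod n)"
        by (intro cong_add w f_cong) (use w in \<open>simp add: cong_add_lcancel_0_nat\<close>)
      finally have "[f (x + (c + f z)) = 0] (mod n)"
        by (simp add: cong_add_lcancel_0_nat add.assoc)
      then show "c + f z \<in> {c. [f (x + c) = 0] (mod n)}" by simp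
    next
      fix c d
      assume "c \<in> {c. [f (x + c) = 0] (mod n)}" and "[c = d] (mod n)"
      then have "[f (x + c) = 0] (mod n)" "[x + d = x + c] (mod n)"
        by (simp_all add: cong_add_lcancel_nat cong_sym)
      then show "d \<in> {c. [f (x + c) = 0] (mod n)}"
        using f_cong cong_trans by blast
    qed
    then show ?thesis by simp
  qed
  have all_zero: "[f z = 0] (mod n)" for z
  proof -
    obtain c where c: "[x + c = z] (mod n)" using shift_exists by blast
    show ?thesis using cong_trans[OF f_cong[OF cong_sym[OF c]] shifted] .
  qed
  have "1 \<in> {c. [c = 0] (mod n)}"
  proof (rule reach)
    show "c + f z \<in> {c. [c = 0] (mod n)}" if "c \<in> {c. [c = 0] (mod n)}" for c z
      using cong_add[of c 0 n "f z" 0] that all_zero by simp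
    show "d \<in> {c. [c = 0] (mod n)}" if "c \<in> {c. [c = 0] (mod n)}" "[c = d] (mod n)" for c d
      using that by (auto intro: cong_trans cong_sym)
  qed simp
  then show False using modulus by (simp add: cong_def)
qed

text \<open>Having the same left multiplication is a congruence: \<open>exchange\<close> expresses
  \<open>f (x + f z)\<close> through \<open>f z\<close> and \<open>f x\<close> alone. By transitivity it is invariant under all
  translations, so it is the congruence modulo the group of periods.\<close>

lemma equal_values_imp_period:
  assumes xy: "[f x = f y] (mod n)" and le: "x \<le> y"
  shows "period_mod n f (y - x)"
proof -
  have shifted: "[f (x + c) = f (y + c)] (mod n)" for c
  proof -
    have "c \<in> {c. [f (x + c) = f (y + c)] (mod n)}"
    proof (rule reach)
      show "0 \<in> {c. [f (x + c) = f (y + c)] (mod n)}" using xy by simp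
    next
      fix c z
      assume "c \<in> {c. [f (x + c) = f (y + c)] (mod n)}"
      then have c: "[f (x + c) = f (y + c)] (mod n)" by simp
      have "[f z + f (x + c + f z) = f (x + c) + f (z + f (x + c))] (mod n)"
        by (rule exchange)
      also have "[f (x + c) + f (z + f (x + c)) = f (y + c) + f (z + f (y + c))] (mod n)"
        by (intro cong_add c f_cong) simp
      also have "[f (y + c) + f (z + f (y + c)) = f z + f (y + c + f z)] (mod n)"
        by (rule exchange)
      finally show "c + f z \<in> {c. [f (x + c) = f (y + c)] (mod n)}"
        by (simp add: cong_add_lcancel_nat add.assoc)
    next
      fix c d
      assume "c \<in> {c. [f (x + c) = f (y + c)] (mod n)}" and cd: "[c = d] (mod n)"
      then have c: "[f (x + c) = f (y + c)] (mod n)" by simp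
      have "[f (x + d) = f (x + c)] (mod n)" "[f (y + c) = f (y + d)] (mod n)"
        using cd by (auto intro!: f_cong simp: cong_add_lcancel_nat cong_sym)
      then show "d \<in> {c. [f (x + c) = f (y + c)] (mod n)}"
        using c by (blast intro: cong_trans)
    qed
    then show ?thesis by simp
  qed
  show ?thesis unfolding period_mod_def
  proof
    fix z
    obtain c where c: "[x + c = z] (mod n)" using shift_exists by blast
    have yc: "y + c = x + c + (y - x)" using le by simp
    have "[f (z + (y - x)) = f (y + c)] (mod n)"
      unfolding yc by (rule f_cong) (use c in \<open>simp add: cong_add_rcancel_nat cong_sym\<close>)
    also have "[f (y + c) = f (x + c)] (mod n)"
      using shifted by (rule cong_sym)
    also have "[f (x + c) = f z] (mod n)"
      by (rule f_cong) (rule c)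
    finally show "[f (z + (y - x)) = f z] (mod n)" .
  qed
qed

text \<open>Since zero is not attained, \<open>f\<close> takes fewer than \<open>n\<close> values modulo \<open>n\<close>.\<close>

lemma obtains_proper_period:
  obtains h where "0 < h" "h < n" "period_mod n f h"
proof -
  have "(\<lambda>x. f x mod n) ` {..<n} \<subseteq> {1..<n}"
  proof
    fix v assume "v \<in> (\<lambda>x. f x mod n) ` {..<n}"
    then obtain x where v: "v = f x mod n" by blast
    have "v \<noteq> 0" using value_not_zero[of x] v by (auto simp: cong_def)
    then show "v \<in> {1..<n}" using modulus v by simp
  qed
  then have "card ((\<lambda>x. f x mod n) ` {..<n}) \<le> n - 1"
    using card_mono[of "{1..<n}"] by simp
  then have "\<not> inj_on (\<lambda>x. f x mod n) {..<n}"
    using modulus by (auto dest: card_image)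
  then obtain x y where "x < y" "y < n" and eq: "[f x = f y] (mod n)"
    by (auto simp: inj_on_def cong_def) (metis linorder_neqE_nat)
  then show ?thesis
    using that[of "y - x"] equal_values_imp_period[OF eq] by simp
qed

lemma constant_if_prime:
  assumes "prime n"
  shows "[f x = f y] (mod n)"
proof -
  obtain h where h: "0 < h" "h < n" "period_mod n f h"
    using obtains_proper_period .
  have "\<not> n dvd h" using h(1,2) nat_dvd_not_less by blast
  then have "coprime h n"
    using prime_imp_coprime[OF assms] coprime_commute by blast
  then have "period_mod n f 1"
    using period_mod_gcd[OF h(3) modulus_period] by simp
  then show ?thesis by (rule period_mod_one)
qed

text \<open>Since the left multiplication by \<open>x\<close> depends only on \<open>x\<close> modulo the period \<open>b\<close>, the
  operation \<open>x \<cdot> y = y + f x\<close> descends to the integers modulo \<open>b\<close>.\<close>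

lemma reduce_modulus:
  assumes "b dvd n" and "1 < b" and "period_mod n f b"
  shows "translation_cycle_set b f"
proof
  show "1 < b" by fact
  show "period_mod b f b"
    using assms(1,3) cong_dvd_modulus_nat unfolding period_mod_def by blast
  show "[f x + f (y + f x) = f y + f (x + f y)] (mod b)" for x y
    using exchange assms(1) cong_dvd_modulus_nat by blast
  show "c \<in> S" if zero: "0 \<in> S" and step: "\<And>c z. c \<in> S \<Longrightarrow> c + f z \<in> S"
    and closed: "\<And>c d. \<lbrakk>c \<in> S; [c = d] (mod b)\<rbrakk> \<Longrightarrow> d \<in> S" for c S
  proof (rule reach[OF zero step])
    show "d \<in> S" if "c \<in> S" "[c = d] (mod n)" for c d
      using closed[OF that(1) cong_dvd_modulus_nat[OF that(2) assms(1)]] .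
  qed
qed

text \<open>Modulo \<open>b\<close> the map \<open>f\<close> is a non-zero constant \<open>c\<close>, so modulo \<open>n\<close> the exchange law becomes
  \<open>f x + f (y + c) = f y + f (x + c)\<close>: the increments of \<open>f\<close> along steps of length \<open>c\<close> are all
  equal. After \<open>b\<close> such steps \<open>f\<close> returns to its value, so \<open>b\<close> times the increment vanishes
  modulo \<open>a * b\<close>; it therefore vanishes modulo \<open>a\<close>, besides vanishing modulo \<open>b\<close>. Hence \<open>c\<close> is a
  period, coprime to the period \<open>b\<close>.\<close>

lemma constant_if_prime_period:
  assumes n: "n = a * b" and b: "prime b" and ab: "coprime a b" and per: "period_mod n f b"
  shows "[f x = f y] (mod n)"
proof -
  define c where "c = f 0"
  have b1: "1 < b" using b prime_gt_1_nat by blast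
  interpret reduced: translation_cycle_set b f
    using reduce_modulus n b1 per by simp
  have fb: "[f x = c] (mod b)" for x
    unfolding c_def using reduced.constant_if_prime[OF b] .
  have step: "[f x + f (y + c) = f y + f (x + c)] (mod n)" for x y
  proof -
    have *: "[f (u + f v) = f (u + c)] (mod n)" for u v
      using period_mod_cong[OF per] fb by (simp add: cong_add_lcancel_nat)
    have "[f x + f (y + c) = f x + f (y + f x)] (mod n)"
      using * by (simp add: cong_add_lcancel_nat cong_sym)
    also have "[f x + f (y + f x) = f y + f (x + f y)] (mod n)" by (rule exchange)
    also have "[f y + f (x + f y) = f y + f (x + c)] (mod n)"
      using * by (simp add: cong_add_lcancel_nat)
    finally show ?thesis .
  qed
  have progression: "[f (k * c) + k * f 0 = f 0 + k * f c] (mod n)" for k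
  proof (induction k)
    case (Suc k)
    have "[(f 0 + f (k * c + c)) + k * f 0 = (f (k * c) + f (0 + c)) + k * f 0] (mod n)"
      by (intro cong_add step) simp
    also have "(f (k * c) + f (0 + c)) + k * f 0 = (f (k * c) + k * f 0) + f c" by simp
    also have "[\<dots> = (f 0 + k * f c) + f c] (mod n)"
      by (intro cong_add Suc.IH) simp
    finally show ?case by (simp add: algebra_simps)
  qed simp
  have "[f 0 + b * f 0 = f (b * c) + b * f 0] (mod n)"
    by (intro cong_add period_mod_cong[OF per]) (simp_all add: cong_def)
  also have "[f (b * c) + b * f 0 = f 0 + b * f c] (mod n)" by (rule progression)
  finally have "[b * f 0 = b * f c] (mod (b * a))"
    using n by (simp add: cong_add_lcancel_nat mult.commute)
  then have "[f 0 = f c] (mod a)"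
    using b1 by (simp add: cong_def mult_mod_right[symmetric])
  moreover have "[f 0 = f c] (mod b)"
    using reduced.constant_if_prime[OF b] .
  ultimately have "[f 0 = f c] (mod n)"
    using coprime_cong_mult_nat[OF _ _ ab] unfolding n by blast
  then have "period_mod n f c"
    using equal_values_imp_period[of 0 c] by simp
  moreover have "coprime c b"
  proof -
    have "\<not> b dvd c" using reduced.value_not_zero[of 0] by (simp add: c_def cong_0_iff)
    then show ?thesis using prime_imp_coprime[OF b] coprime_commute by blast
  qed
  ultimately have "period_mod n f 1"
    using period_mod_gcd[OF _ per] by simp
  then show ?thesis by (rule period_mod_one)
qed

lemma constant_if_product_of_two_primes:
  assumes n: "n = p * q" and p: "prime p" and q: "prime q" and pq: "p \<noteq> q"
  shows "[f x = f y] (mod n)"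
proof -
  have cop: "coprime p q" using primes_coprime p q pq by blast
  obtain h where h: "0 < h" "h < n" "period_mod n f h"
    using obtains_proper_period .
  have "\<not> n dvd h" using h(1,2) nat_dvd_not_less by blast
  \<comment> \<open>If one prime does not divide \<open>h\<close>, then \<open>gcd h n\<close> divides the other, which is thus a period.\<close>
  then consider "\<not> p dvd h" | "\<not> q dvd h"
    using divides_mult[OF _ _ cop] n by blast
  then show ?thesis
  proof cases
    case 1
    then have "coprime h p" using prime_imp_coprime[OF p] coprime_commute by blast
    then have "coprime (gcd h n) p" using coprime_divisors[OF gcd_dvd1 dvd_refl] by blast
    then have "gcd h n dvd q"
      using gcd_dvd2[of h n] n coprime_dvd_mult_right_iff by metis
    then have "period_mod n f q"
      using period_mod_gcd[OF h(3) modulus_period] by blast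
    then show ?thesis using constant_if_prime_period[OF n q cop] by blast
  next
    case 2
    then have "coprime h q" using prime_imp_coprime[OF q] coprime_commute by blast
    then have "coprime (gcd h n) q" using coprime_divisors[OF gcd_dvd1 dvd_refl] by blast
    then have "gcd h n dvd p"
      using gcd_dvd2[of h n] n coprime_dvd_mult_left_iff by metis
    then have "period_mod n f p"
      using period_mod_gcd[OF h(3) modulus_period] by blast
    then show ?thesis
      using constant_if_prime_period[of q p] n p cop by (simp add: mult.commute coprime_commute)
  qed
qed

end

section \<open>Coordinates on a cycle set with cyclic permutation group\<close>

lemma BijGroup_nat_pow_apply:
  assumes "\<alpha> \<in> carrier (BijGroup S)" and "y \<in> S"
  shows "(\<alpha> [^]\<^bsub>BijGroup S\<^esub> (k::nat)) y = (\<alpha> ^^ k) y"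
  using assms(2)
proof (induction k arbitrary: y)
  case 0
  then show ?case by (simp add: BijGroup_def)
next
  case (Suc k)
  interpret group "BijGroup S" by (rule group_BijGroup)
  have "\<alpha> [^]\<^bsub>BijGroup S\<^esub> k \<in> Bij S" "\<alpha> \<in> Bij S"
    using assms(1) nat_pow_closed[of \<alpha> k] unfolding BijGroup_def by simp_all
  moreover have "(g \<otimes>\<^bsub>BijGroup S\<^esub> h) y = g (h y)" if "g \<in> Bij S" "h \<in> Bij S" for g h
    using that Suc.prems by (simp add: BijGroup_def compose_def)
  ultimately have "(\<alpha> [^]\<^bsub>BijGroup S\<^esub> Suc k) y = (\<alpha> [^]\<^bsub>BijGroup S\<^esub> k) (\<alpha> y)"
    by simp
  also have "\<dots> = (\<alpha> ^^ k) (\<alpha> y)"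
    using Suc.IH funcset_mem[OF Bij_imp_funcset[OF \<open>\<alpha> \<in> Bij S\<close>] Suc.prems] .
  finally show ?case by (simp add: funpow_swap1)
qed

lemma lmult_power_of_generator:
  assumes X: "cycle_set X" and fin: "finite (carrier X)" and cyc: "cyclic_group (perm_group X)"
  obtains \<alpha> e where "bij_betw \<alpha> (carrier X) (carrier X)"
    and "\<And>x y. \<lbrakk>x \<in> carrier X; y \<in> carrier X\<rbrakk> \<Longrightarrow> x \<cdot>\<^bsub>X\<^esub> y = (\<alpha> ^^ e x) y"
proof -
  let ?B = "BijGroup (carrier X)"
  interpret B: group ?B by (rule group_BijGroup)
  interpret P: group "perm_group X"
    unfolding perm_group_def by (rule B.group_subgroup_generated)
  have sub: "carrier (perm_group X) \<subseteq> carrier ?B"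
    unfolding perm_group_def by (rule B.carrier_subgroup_generated_subset)
  have "carrier ?B \<subseteq> carrier X \<rightarrow>\<^sub>E carrier X"
    by (auto simp: BijGroup_def Bij_def PiE_def dest: bij_betw_imp_funcset)
  then have "finite (carrier ?B)"
    using fin finite_PiE finite_subset by metis
  then have finG: "finite (carrier (perm_group X))" using sub finite_subset by blast
  obtain \<alpha> where \<alpha>: "\<alpha> \<in> carrier (perm_group X)" "subgroup_generated (perm_group X) {\<alpha>} = perm_group X"
    using cyc unfolding cyclic_group_def by blast
  have "carrier (perm_group X) = generate (perm_group X) {\<alpha>}"
    using \<alpha> carrier_subgroup_generated[of "perm_group X" "{\<alpha>}"] by simp
  also have "\<dots> = {\<alpha> [^]\<^bsub>perm_group X\<^esub> k | k. k \<in> (UNIV::nat set)}"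
    by (rule P.generate_pow_on_finite_carrier[OF finG \<alpha>(1)])
  also have "\<dots> = {\<alpha> [^]\<^bsub>?B\<^esub> k | k. k \<in> (UNIV::nat set)}"
    unfolding perm_group_def by (simp add: pow_subgroup_generated)
  finally have pow: "carrier (perm_group X) = {\<alpha> [^]\<^bsub>?B\<^esub> k | k. k \<in> (UNIV::nat set)}" .
  have "\<exists>k::nat. \<sigma>\<^bsub>X\<^esub> x = \<alpha> [^]\<^bsub>?B\<^esub> k" if "x \<in> carrier X" for x
  proof -
    have "\<sigma>\<^bsub>X\<^esub> x \<in> carrier ?B"
      using X that unfolding cycle_set_def BijGroup_def Bij_def by (simp add: lmult_def)
    then have "\<sigma>\<^bsub>X\<^esub> x \<in> carrier (perm_group X)"
      unfolding perm_group_def carrier_subgroup_generated using that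
      by (intro generate.incl) blast
    then show ?thesis using pow by blast
  qed
  then obtain e :: "'a \<Rightarrow> nat" where e: "\<And>x. x \<in> carrier X \<Longrightarrow> \<sigma>\<^bsub>X\<^esub> x = \<alpha> [^]\<^bsub>?B\<^esub> e x"
    by metis
  have aB: "\<alpha> \<in> carrier ?B" using \<alpha> sub by blast
  show ?thesis
  proof
    show "bij_betw \<alpha> (carrier X) (carrier X)" using aB by (simp add: BijGroup_def Bij_def)
    show "x \<cdot>\<^bsub>X\<^esub> y = (\<alpha> ^^ e x) y" if "x \<in> carrier X" "y \<in> carrier X" for x y
      using fun_cong[OF e[OF that(1)], of y] that(2) BijGroup_nat_pow_apply[OF aB that(2)]
      by (simp add: lmult_def)
  qed
qed

text \<open>By finiteness an invariant set has an invariant complement, so indecomposability leaves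
  no proper non-empty invariant set.\<close>

lemma indecomposable_invariant_eq_carrier:
  assumes X: "cycle_set X" and fin: "finite (carrier X)" and ind: "indecomposable X"
    and Y: "Y \<subseteq> carrier X" "Y \<noteq> {}"
    and inv: "\<And>x y. \<lbrakk>x \<in> carrier X; y \<in> Y\<rbrakk> \<Longrightarrow> x \<cdot>\<^bsub>X\<^esub> y \<in> Y"
  shows "Y = carrier X"
proof (rule ccontr)
  assume ne: "Y \<noteq> carrier X"
  have "\<sigma>\<^bsub>X\<^esub> x ` Y \<subseteq> Y \<and> \<sigma>\<^bsub>X\<^esub> x ` (carrier X - Y) \<subseteq> carrier X - Y" if x: "x \<in> carrier X" for x
  proof -
    have bij: "bij_betw (\<sigma>\<^bsub>X\<^esub> x) (carrier X) (carrier X)"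
      using X x unfolding cycle_set_def by blast
    have 1: "\<sigma>\<^bsub>X\<^esub> x ` Y \<subseteq> Y"
      using inv[OF x] Y(1) by (auto simp: lmult_def subset_iff)
    have inj: "inj_on (\<sigma>\<^bsub>X\<^esub> x) Y" using bij Y(1) inj_on_subset unfolding bij_betw_def by blast
    have "\<sigma>\<^bsub>X\<^esub> x ` Y = Y"
      using endo_inj_surj[OF finite_subset[OF Y(1) fin] 1 inj] .
    moreover have "\<sigma>\<^bsub>X\<^esub> x ` (carrier X - Y) = \<sigma>\<^bsub>X\<^esub> x ` carrier X - \<sigma>\<^bsub>X\<^esub> x ` Y"
      using bij Y(1) unfolding bij_betw_def by (intro inj_on_image_set_diff[of _ "carrier X"]) auto
    ultimately show ?thesis using bij unfolding bij_betw_def by simp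
  qed
  moreover have "carrier X - Y \<noteq> {}" "Y \<inter> (carrier X - Y) = {}" "Y \<union> (carrier X - Y) = carrier X"
    using Y ne by auto
  ultimately have "\<exists>Y Z. Y \<noteq> {} \<and> Z \<noteq> {} \<and> Y \<inter> Z = {} \<and> Y \<union> Z = carrier X \<and>
      (\<forall>x\<in>carrier X. \<sigma>\<^bsub>X\<^esub> x ` Y \<subseteq> Y \<and> \<sigma>\<^bsub>X\<^esub> x ` Z \<subseteq> Z)"
    using Y(2) by (intro exI[of _ Y] exI[of _ "carrier X - Y"] conjI ballI) simp_all
  then show False using ind unfolding indecomposable_def by contradiction
qed

text \<open>The least positive exponent \<open>d\<close> with \<open>(\<alpha> ^^ d) x = x\<close> is the size of the orbit: the powers
  below \<open>d\<close> move \<open>x\<close> to distinct points, and the later ones repeat them.\<close>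

lemma single_orbit_cong_card:
  assumes bij: "bij_betw \<alpha> A A" and fin: "finite A" and x: "x \<in> A"
    and orbit: "A = range (\<lambda>i. (\<alpha> ^^ i) x)"
  shows "(\<alpha> ^^ i) x = (\<alpha> ^^ j) x \<longleftrightarrow> [i = j] (mod card A)"
proof -
  have cancel: "(\<alpha> ^^ (j - i)) x = x" if eq: "(\<alpha> ^^ i) x = (\<alpha> ^^ j) x" and "i \<le> j" for i j
  proof -
    have "inj_on (\<alpha> ^^ i) A" using bij_betw_funpow[OF bij] unfolding bij_betw_def by blast
    moreover have "(\<alpha> ^^ i) ((\<alpha> ^^ (j - i)) x) = (\<alpha> ^^ i) x"
      using eq \<open>i \<le> j\<close> funpow_add[of i "j - i" \<alpha>] by simp
    ultimately show ?thesis using orbit x by (auto dest: inj_onD)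
  qed
  have "\<not> inj (\<lambda>i. (\<alpha> ^^ i) x)" using fin orbit finite_imageD by (metis infinite_UNIV_nat)
  then obtain i0 j0 where "i0 < j0" "(\<alpha> ^^ i0) x = (\<alpha> ^^ j0) x"
    by (auto simp: inj_def) (metis linorder_neqE_nat)
  then have ex: "\<exists>d>0. (\<alpha> ^^ d) x = x" using cancel[of i0 j0] by (intro exI[of _ "j0 - i0"]) simp
  define d where "d = (LEAST d. d > 0 \<and> (\<alpha> ^^ d) x = x)"
  have d: "d > 0" "(\<alpha> ^^ d) x = x" using LeastI_ex[OF ex] unfolding d_def by auto
  have minimal: "d \<le> k" if "k > 0" "(\<alpha> ^^ k) x = x" for k
    unfolding d_def by (rule Least_le) (use that in simp)
  have inj: "inj_on (\<lambda>i. (\<alpha> ^^ i) x) {..<d}"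
  proof (rule linorder_inj_onI)
    fix i j assume "i < j" "i \<in> {..<d}" "j \<in> {..<d}"
    then show "(\<alpha> ^^ i) x \<noteq> (\<alpha> ^^ j) x"
      using cancel[of i j] minimal[of "j - i"] by fastforce
  qed auto
  have mod: "(\<alpha> ^^ (i mod d)) x = (\<alpha> ^^ i) x" for i
    by (rule funpow_mod_eq) (rule d(2))
  have "A = (\<lambda>i. (\<alpha> ^^ i) x) ` {..<d}"
  proof
    show "A \<subseteq> (\<lambda>i. (\<alpha> ^^ i) x) ` {..<d}"
    proof
      fix y assume "y \<in> A"
      then obtain i where "y = (\<alpha> ^^ i) x" using orbit by blast
      then have "y = (\<alpha> ^^ (i mod d)) x" using mod by simp
      then show "y \<in> (\<lambda>i. (\<alpha> ^^ i) x) ` {..<d}" using d(1) by simp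
    qed
  qed (use orbit in blast)
  then have card: "card A = d" using card_image[OF inj] by simp
  show ?thesis
  proof
    assume "(\<alpha> ^^ i) x = (\<alpha> ^^ j) x"
    then have "(\<alpha> ^^ (i mod d)) x = (\<alpha> ^^ (j mod d)) x" using mod by simp
    then show "[i = j] (mod card A)"
      using inj_onD[OF inj] d(1) card by (simp add: cong_def)
  next
    assume "[i = j] (mod card A)"
    then show "(\<alpha> ^^ i) x = (\<alpha> ^^ j) x" using mod card by (metis cong_def)
  qed
qed

text \<open>The point with coordinate \<open>i\<close> is the image under \<open>\<alpha> ^^ i\<close> of a base point. The points that
  arise this way form an invariant set, because every left multiplication is a power of \<open>\<alpha>\<close>; by
  indecomposability they are all of \<open>X\<close>. The same principle, applied to the points whose
  coordinates lie in a given set of residues, gives \<open>reach\<close>.\<close>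

lemma cyclic_perm_group_coordinates:
  assumes X: "cycle_set X" and fin: "finite (carrier X)" and ind: "indecomposable X"
    and cyc: "cyclic_group (perm_group X)" and card: "1 < card (carrier X)"
  obtains pt f where "carrier X = range pt"
    and "\<And>i j. pt i = pt j \<longleftrightarrow> [i = j] (mod card (carrier X))"
    and "\<And>i j. pt i \<cdot>\<^bsub>X\<^esub> pt j = pt (j + f i)"
    and "translation_cycle_set (card (carrier X)) f"
proof -
  let ?n = "card (carrier X)"
  obtain \<alpha> e where bij: "bij_betw \<alpha> (carrier X) (carrier X)"
    and e: "\<And>x y. \<lbrakk>x \<in> carrier X; y \<in> carrier X\<rbrakk> \<Longrightarrow> x \<cdot>\<^bsub>X\<^esub> y = (\<alpha> ^^ e x) y"
    using lmult_power_of_generator[OF X fin cyc] by blast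
  obtain x0 where x0: "x0 \<in> carrier X" using X unfolding cycle_set_def by blast
  define pt where "pt i = (\<alpha> ^^ i) x0" for i
  define f where "f i = e (pt i)" for i
  have pt_in: "pt i \<in> carrier X" for i
    using bij_betw_apply[OF bij_betw_funpow[OF bij] x0] by (simp add: pt_def)
  have dot: "pt i \<cdot>\<^bsub>X\<^esub> pt j = pt (j + f i)" for i j
    using e[OF pt_in pt_in, of i j] by (simp add: f_def pt_def funpow_add add.commute[of j])
  have range: "range pt = carrier X"
  proof (rule indecomposable_invariant_eq_carrier[OF X fin ind])
    show "x \<cdot>\<^bsub>X\<^esub> y \<in> range pt" if x: "x \<in> carrier X" and "y \<in> range pt" for x y
    proof -
      obtain j where j: "y = pt j" using \<open>y \<in> range pt\<close> by blast
      have "x \<cdot>\<^bsub>X\<^esub> y = pt (e x + j)"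
        unfolding j using e[OF x pt_in, of j] by (simp add: pt_def funpow_add)
      then show ?thesis by simp
    qed
  qed (use pt_in in auto)
  have pt_eq: "pt i = pt j \<longleftrightarrow> [i = j] (mod ?n)" for i j
    unfolding pt_def by (rule single_orbit_cong_card[OF bij fin x0]) (use range pt_def in auto)
  have "translation_cycle_set ?n f"
  proof
    show "1 < ?n" by fact
    show "period_mod ?n f ?n" unfolding period_mod_def
    proof
      fix x
      have "pt (x + ?n) = pt x" by (simp add: pt_eq cong_def)
      then show "[f (x + ?n) = f x] (mod ?n)" by (simp add: f_def)
    qed
    show "[f x + f (y + f x) = f y + f (x + f y)] (mod ?n)" for x y
    proof -
      have "(pt x \<cdot>\<^bsub>X\<^esub> pt y) \<cdot>\<^bsub>X\<^esub> (pt x \<cdot>\<^bsub>X\<^esub> pt 0) = (pt y \<cdot>\<^bsub>X\<^esub> pt x) \<cdot>\<^bsub>X\<^esub> (pt y \<cdot>\<^bsub>X\<^esub> pt 0)"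
        using X pt_in unfolding cycle_set_def by blast
      then show ?thesis by (simp add: dot pt_eq)
    qed
    show "c \<in> S" if zero: "0 \<in> S" and step: "\<And>c z. c \<in> S \<Longrightarrow> c + f z \<in> S"
      and closed: "\<And>c d. \<lbrakk>c \<in> S; [c = d] (mod ?n)\<rbrakk> \<Longrightarrow> d \<in> S" for c S
    proof -
      have "pt ` S = carrier X"
      proof (rule indecomposable_invariant_eq_carrier[OF X fin ind])
        show "x \<cdot>\<^bsub>X\<^esub> y \<in> pt ` S" if x: "x \<in> carrier X" and y: "y \<in> pt ` S" for x y
        proof -
          obtain i where "x = pt i" using x range by blast
          moreover obtain j where "y = pt j" "j \<in> S" using y by blast
          ultimately show ?thesis using step dot by simp
        qed
      qed (use pt_in zero in auto)
      then obtain s where "s \<in> S" "pt s = pt c" using pt_in[of c] by (metis imageE)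
      then show ?thesis using closed pt_eq by blast
    qed
  qed
  then show ?thesis using that range pt_eq dot by blast
qed

section \<open>Multipermutation level one\<close>

lemma multipermutational_of_level_1I:
  assumes "carrier X \<noteq> {}" and "card (carrier X) \<noteq> 1"
    and const: "\<And>x y. \<lbrakk>x \<in> carrier X; y \<in> carrier X\<rbrakk> \<Longrightarrow> \<sigma>\<^bsub>X\<^esub> x = \<sigma>\<^bsub>X\<^esub> y"
  shows "multipermutational_of_level X 1"
proof -
  obtain x where x: "x \<in> carrier X" using assms(1) by blast
  have "\<sigma>\<^bsub>X\<^esub> ` carrier X = {\<sigma>\<^bsub>X\<^esub> x}" using x const by blast
  then have "card (carrier (retraction X)) = 1" by (simp add: retraction_def)
  then have "card (carrier (retract X)) = 1" using bij_betw_same_card[OF retract_bij, of X] by simp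
  then show ?thesis using assms(2) by (simp add: multipermutational_of_level_def)
qed

theorem proposition16:
  fixes X :: "'a magma" and p q :: nat
  assumes "prime p" and "prime q" and "p < q"
    and "cycle_set X" and "finite (carrier X)" and "indecomposable X"
    and "card (carrier X) = p * q"
    and "cyclic_group (perm_group X)"
  shows "multipermutational_of_level X 1"
proof -
  have card: "1 < card (carrier X)"
    using assms(1,2,7) prime_gt_1_nat less_1_mult by metis
  obtain pt f where range: "carrier X = range pt"
    and pt_eq: "\<And>i j. pt i = pt j \<longleftrightarrow> [i = j] (mod card (carrier X))"
    and dot: "\<And>i j. pt i \<cdot>\<^bsub>X\<^esub> pt j = pt (j + f i)"
    and tcs: "translation_cycle_set (card (carrier X)) f"
    using cyclic_perm_group_coordinates[OF assms(4-6,8) card] by blast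
  have const: "[f i = f j] (mod card (carrier X))" for i j
    using translation_cycle_set.constant_if_product_of_two_primes[OF tcs assms(7,1,2)] assms(3)
    by simp
  show ?thesis
  proof (rule multipermutational_of_level_1I)
    fix x y assume "x \<in> carrier X" "y \<in> carrier X"
    then obtain i j where ij: "x = pt i" "y = pt j" using range by blast
    have "pt i \<cdot>\<^bsub>X\<^esub> pt k = pt j \<cdot>\<^bsub>X\<^esub> pt k" for k
      using const by (simp add: dot pt_eq cong_add_lcancel_nat)
    then show "\<sigma>\<^bsub>X\<^esub> x = \<sigma>\<^bsub>X\<^esub> y"
      unfolding lmult_def ij using range by (intro restrict_ext) auto
  qed (use card in auto)
qed

end
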